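(* Let $(\Omega,\mathcal{F},P)$ be a probability space and $\{A_n\}_{n\ge 1}$ a sequence of events. Put $S_n=\sum_{k=1}^n \mathbb{I}(A_k)$ and $E_n=\sum_{k=1}^n P(A_k)$. Let $\psi(x)$, $x\ge 0$, be a non-decreasing positive function with $\sum_{n=1}^\infty \frac{1}{n\psi(n)}<\infty$, and let $g(x)$, $x\ge 0$, be a positive function such that $g(x)/x$ and $x^{2-\delta}/g(x)$ are non-decreasing for some $\delta\in(0,1)$. Assume that $E_n\to\infty$ as $n\to\infty$ and that $$\mathrm{Var}(S_m-S_n)\le g(E_m-E_n)$$ for all $m>n$ and all sufficiently large $n$. Then $$S_n=E_n+o\left(\sqrt{g(E_n)\,\psi(\log E_n)}\,(\log E_n)^{3/2}\right)\quad\text{almost surely as } n\to\infty.$$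
   Context: $\mathbb{I}(A)$ denotes the indicator of the event $A$. The relation $S_n=E_n+o(h_n)$ almost surely means that $(S_n-E_n)/h_n\to 0$ as $n\to\infty$ with probability one. *)

theory Defs
  imports "HOL-Probability.Probability"
begin

text \<open>Events are indexed from 1, so the value of \<open>A\<close> at 0 is never used.\<close>

definition occurrences :: "(nat \<Rightarrow> 'a set) \<Rightarrow> nat \<Rightarrow> 'a \<Rightarrow> real" where
  "occurrences A n \<omega> = (\<Sum>k=1..n. indicator (A k) \<omega>)"

definition prob_sum :: "'a measure \<Rightarrow> (nat \<Rightarrow> 'a set) \<Rightarrow> nat \<Rightarrow> real" where
  "prob_sum M A n = (\<Sum>k=1..n. measure M (A k))"

end

theory Submission
  imports Defs
begin

text \<open>
  The theorem is the strong law of Gal--Koksma type, obtained from variances of blocks by a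
  Rademacher--Menshov maximal inequality.

  Since the means grow by at most one per step, it suffices to control \<open>S - E\<close> at the times
  \<open>\<tau> k\<close> at which \<open>E\<close> first gains \<open>k\<close> over its value at an index \<open>N\<close> beyond which the variance
  bound holds: as \<open>S\<close> and \<open>E\<close> are both non-decreasing, in between the deviation changes only by a
  bounded amount (\<open>deviation_between_levels\<close>).  Let \<open>Y k\<close> be the deviation at \<open>\<tau> k\<close>.  The
  increment of \<open>Y\<close> over \<open>d\<close> levels has second moment at most \<open>g (2 d)\<close>.

  Halving the block repeatedly, every integer up to \<open>2 ^ J\<close> is reached from 0 by at most one
  dyadic step for each of the \<open>J\<close> halvings and a final unit step, so by Cauchy--Schwarz the
  squared increments of \<open>Y\<close> from 0 are all at most \<open>J + 1\<close> times the sum of the squares of the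
  dyadic increments that can occur (\<open>increment_le_dyadic_energy\<close>).  Because \<open>g x / x\<close> is
  non-decreasing, the at most \<open>2 ^ (J - r)\<close> increments of length \<open>2 ^ r\<close> that belong to one stage
  contribute in total no more than a single one of length \<open>2 ^ J\<close> may, so the expected sum of squares is at most \<open>J + 1\<close> times
  \<open>g (2 * 2 ^ J)\<close> (\<open>integral_dyadic_energy_le\<close>).  Hence the expected maximum of \<open>(Y k - Y 0)\<^sup>2\<close>
  over \<open>k \<le> 4 ^ (j + 1)\<close> is of order \<open>j\<^sup>2 * g (4 ^ j)\<close>; here the upper growth condition on \<open>g\<close>
  absorbs a constant factor in the argument.

  For \<open>x \<ge> 4 ^ j\<close> one has \<open>ln x \<ge> j\<close>, so the square of the normalisation at \<open>x\<close> is at least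
  \<open>H j = g (4 ^ j) * \<psi> j * j ^ 3\<close>.  The expected maxima divided by \<open>H j\<close> are therefore of order
  \<open>1 / (j * \<psi> j)\<close>, which is summable.  So the normalised maxima have an almost surely convergent
  sum (\<open>AE_tendsto_0_of_summable_integrals\<close>) and tend to 0, which is the claim with a little o.
\<close>

section \<open>The Rademacher--Menshov maximal inequality\<close>

text \<open>
  The sum of the squared increments that can occur on the way from \<open>b\<close> to a point of the block of
  length \<open>2 ^ J\<close> starting at \<open>b\<close>.  A point in the left half of a block is reached inside that half,
  and one in the right half by first crossing the left half, so right halves are never crossed as a
  whole, except for the unit steps that end the recursion.  Unit left halves count twice, as the
  crossing and as the unit step.
\<close>
fun dyadic_energy :: "(nat \<Rightarrow> real) \<Rightarrow> nat \<Rightarrow> nat \<Rightarrow> real" where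
  "dyadic_energy y b 0 = (y (b + 1) - y b)\<^sup>2"
| "dyadic_energy y b (Suc J) =
     (y (b + 2 ^ J) - y b)\<^sup>2 + dyadic_energy y b J + dyadic_energy y (b + 2 ^ J) J"

lemma dyadic_energy_nonneg: "dyadic_energy y b J \<ge> 0"
  by (induction J arbitrary: b) auto

text \<open>
  Cauchy--Schwarz with weights \<open>c\<close> and 1, chosen so that the constant in the maximal inequality
  grows by exactly one with each doubling of the block.
\<close>
lemma weighted_square_sum_le:
  fixes a b c :: real
  assumes "c > 0"
  shows "(a + b)\<^sup>2 \<le> (c + 1) * (a\<^sup>2 / c + b\<^sup>2)"
proof -
  have "c * (a + b)\<^sup>2 \<le> (c + 1) * (a\<^sup>2 + c * b\<^sup>2)"
    using zero_le_power2[of "a - c * b"] by (simp add: power2_eq_square algebra_simps)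
  also have "\<dots> = c * ((c + 1) * (a\<^sup>2 / c + b\<^sup>2))"
    using assms by (simp add: field_simps)
  finally show ?thesis
    using assms by simp
qed

text \<open>
  The bound is uniform in \<open>k\<close>, so it is a pointwise bound for a maximum.  In the right half of a
  block the increment is the sum of one step over the left half and an increment inside the right
  half, to which the induction hypothesis applies.
\<close>
lemma increment_le_dyadic_energy:
  assumes "k \<le> 2 ^ J"
  shows "(y (b + k) - y b)\<^sup>2 \<le> (real J + 1) * dyadic_energy y b J"
  using assms
proof (induction J arbitrary: b k)
  case 0
  then have "k = 0 \<or> k = 1" by auto
  then show ?case by auto
next
  case (Suc J)
  let ?c = "b + 2 ^ J"
  show ?case
  proof (cases "k \<le> 2 ^ J")
    case True
    have "(y (b + k) - y b)\<^sup>2 \<le> (real J + 1) * dyadic_energy y b J"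
      by (rule Suc.IH[OF True])
    also have "\<dots> \<le> (real (Suc J) + 1) * dyadic_energy y b (Suc J)"
      by (intro mult_mono) (auto simp: dyadic_energy_nonneg)
    finally show ?thesis .
  next
    case False
    define l where "l = k - 2 ^ J"
    have k: "b + k = ?c + l" and l: "l \<le> 2 ^ J"
      using False Suc.prems by (auto simp: l_def)
    let ?u = "y (?c + l) - y ?c" and ?v = "y ?c - y b"
    have "(y (b + k) - y b)\<^sup>2 = (?u + ?v)\<^sup>2"
      by (simp add: k)
    also have "\<dots> \<le> (real J + 1 + 1) * (?u\<^sup>2 / (real J + 1) + ?v\<^sup>2)"
      by (rule weighted_square_sum_le) simp
    also have "\<dots> \<le> (real J + 1 + 1) * (dyadic_energy y ?c J + ?v\<^sup>2)"
    proof -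
      have "?u\<^sup>2 / (real J + 1) \<le> dyadic_energy y ?c J"
        using Suc.IH[OF l, of ?c] by (simp add: pos_divide_le_eq mult.commute)
      then show ?thesis by (intro mult_left_mono) auto
    qed
    also have "\<dots> \<le> (real (Suc J) + 1) * dyadic_energy y b (Suc J)"
      by (intro mult_mono) (auto simp: dyadic_energy_nonneg)
    finally show ?thesis .
  qed
qed

text \<open>
  The doubling condition makes the two halves of a block together contribute no more than the
  bound for the whole block; each of the \<open>J + 1\<close> scales then costs at most \<open>G (2 ^ J)\<close>.
\<close>
lemma integral_dyadic_energy_le:
  fixes Y :: "nat \<Rightarrow> 'a \<Rightarrow> real" and G :: "nat \<Rightarrow> real"
  assumes int: "\<And>s t. s < t \<Longrightarrow> integrable M (\<lambda>\<omega>. (Y t \<omega> - Y s \<omega>)\<^sup>2)"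
    and le: "\<And>s t. s < t \<Longrightarrow> (\<integral>\<omega>. (Y t \<omega> - Y s \<omega>)\<^sup>2 \<partial>M) \<le> G (t - s)"
    and double: "\<And>J. 2 * G (2 ^ J) \<le> G (2 ^ Suc J)"
  shows "integrable M (\<lambda>\<omega>. dyadic_energy (\<lambda>k. Y k \<omega>) b J)"
    and "(\<integral>\<omega>. dyadic_energy (\<lambda>k. Y k \<omega>) b J \<partial>M) \<le> (real J + 1) * G (2 ^ J)"
proof -
  have "integrable M (\<lambda>\<omega>. dyadic_energy (\<lambda>k. Y k \<omega>) b J) \<and>
        (\<integral>\<omega>. dyadic_energy (\<lambda>k. Y k \<omega>) b J \<partial>M) \<le> (real J + 1) * G (2 ^ J)"
  proof (induction J arbitrary: b)
    case 0
    show ?case using int[of b "b + 1"] le[of b "b + 1"] by simp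
  next
    case (Suc J)
    let ?c = "b + 2 ^ J"
    have i: "integrable M (\<lambda>\<omega>. (Y ?c \<omega> - Y b \<omega>)\<^sup>2)"
      and l: "(\<integral>\<omega>. (Y ?c \<omega> - Y b \<omega>)\<^sup>2 \<partial>M) \<le> G (2 ^ J)"
      using int[of b ?c] le[of b ?c] by auto
    have "(\<integral>\<omega>. dyadic_energy (\<lambda>k. Y k \<omega>) b (Suc J) \<partial>M)
        \<le> G (2 ^ J) + (real J + 1) * G (2 ^ J) + (real J + 1) * G (2 ^ J)"
      using i l Suc.IH[of b] Suc.IH[of ?c] by simp
    also have "\<dots> = (real J + 3 / 2) * (2 * G (2 ^ J))"
      by (simp add: algebra_simps)
    also have "\<dots> \<le> (real J + 3 / 2) * G (2 ^ Suc J)"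
      by (intro mult_left_mono double) simp
    also have "\<dots> \<le> (real (Suc J) + 1) * G (2 ^ Suc J)"
    proof -
      have "0 \<le> (\<integral>\<omega>. (Y (2 ^ Suc J) \<omega> - Y 0 \<omega>)\<^sup>2 \<partial>M)"
        by simp
      also have "\<dots> \<le> G (2 ^ Suc J)"
        using le[of 0 "2 ^ Suc J"] by simp
      finally show ?thesis by (intro mult_right_mono) auto
    qed
    finally show ?case
      using i Suc.IH[of b] Suc.IH[of ?c] by simp
  qed
  then show "integrable M (\<lambda>\<omega>. dyadic_energy (\<lambda>k. Y k \<omega>) b J)"
    and "(\<integral>\<omega>. dyadic_energy (\<lambda>k. Y k \<omega>) b J \<partial>M) \<le> (real J + 1) * G (2 ^ J)"
    by auto
qed

section \<open>Almost sure convergence from summable means\<close>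

text \<open>
  By monotone convergence \<open>\<Sum>i. f i\<close> has finite integral, hence is finite almost everywhere, and
  the terms of a convergent series tend to 0.  This replaces a Borel--Cantelli argument for each
  threshold separately.
\<close>
lemma AE_tendsto_0_of_summable_integrals:
  fixes f :: "nat \<Rightarrow> 'a \<Rightarrow> real"
  assumes int: "\<And>i. integrable M (f i)"
    and nonneg: "\<And>i \<omega>. 0 \<le> f i \<omega>"
    and summ: "summable (\<lambda>i. \<integral>\<omega>. f i \<omega> \<partial>M)"
  shows "AE \<omega> in M. (\<lambda>i. f i \<omega>) \<longlonglongrightarrow> 0"
proof -
  have [measurable]: "f i \<in> borel_measurable M" for i
    using int by auto
  have "(\<integral>\<^sup>+\<omega>. (\<Sum>i. ennreal (f i \<omega>)) \<partial>M) = (\<Sum>i. \<integral>\<^sup>+\<omega>. ennreal (f i \<omega>) \<partial>M)"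
    by (rule nn_integral_suminf) measurable
  also have "\<dots> = (\<Sum>i. ennreal (\<integral>\<omega>. f i \<omega> \<partial>M))"
    by (simp add: nn_integral_eq_integral int nonneg)
  also have "\<dots> \<noteq> \<infinity>"
    using summ by (simp add: suminf_ennreal2 nonneg)
  finally have "AE \<omega> in M. (\<Sum>i. ennreal (f i \<omega>)) \<noteq> \<infinity>"
    by (intro nn_integral_PInf_AE) auto
  then show ?thesis
  proof (rule AE_mp, intro AE_I2 impI)
    fix \<omega> assume "(\<Sum>i. ennreal (f i \<omega>)) \<noteq> \<infinity>"
    then have "summable (\<lambda>i. f i \<omega>)"
      by (intro summable_suminf_not_top) (auto simp: nonneg)
    then show "(\<lambda>i. f i \<omega>) \<longlonglongrightarrow> 0"
      by (rule summable_LIMSEQ_zero)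
  qed
qed

section \<open>Interpolation between level times\<close>

text \<open>
  \<open>\<tau> k\<close> is the first index from \<open>N\<close> on at which \<open>e\<close> has gained \<open>k\<close>.  Steps of size at most 1
  make the overshoot less than 1; the strict bound makes level times with different \<open>k\<close> distinct
  when \<open>e\<close> is monotone.
\<close>
lemma level_times_exist:
  fixes e :: "nat \<Rightarrow> real"
  assumes step: "\<And>n. e (Suc n) \<le> e n + 1"
    and lim: "filterlim e at_top sequentially"
  obtains \<tau> :: "nat \<Rightarrow> nat"
  where "\<And>k. N \<le> \<tau> k" "\<And>k. e N + real k \<le> e (\<tau> k)" "\<And>k. e (\<tau> k) < e N + real k + 1"
    "\<And>k n. N \<le> n \<Longrightarrow> e N + real k \<le> e n \<Longrightarrow> \<tau> k \<le> n"
proof -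
  define P where "P k n \<longleftrightarrow> N \<le> n \<and> e N + real k \<le> e n" for k n
  define \<tau> where "\<tau> k = (LEAST n. P k n)" for k
  have ex: "\<exists>n. P k n" for k
  proof -
    have "\<forall>\<^sub>F n in sequentially. e N + real k \<le> e n"
      using lim by (simp add: filterlim_at_top)
    then have "\<forall>\<^sub>F n in sequentially. P k n"
      using eventually_ge_at_top[of N] by eventually_elim (simp add: P_def)
    then show ?thesis
      by (auto simp: eventually_sequentially)
  qed
  have P: "P k (\<tau> k)" for k
    unfolding \<tau>_def using ex[of k] by (rule LeastI_ex)
  have upper: "e (\<tau> k) < e N + real k + 1" for k
  proof (cases "\<tau> k = N")
    case False
    then obtain n where n: "\<tau> k = Suc n" "N \<le> n"
      using P[of k] by (cases "\<tau> k") (auto simp: P_def)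
    have "\<not> P k n"
      using not_less_Least[of n "P k"] n(1) by (simp add: \<tau>_def)
    then show ?thesis
      using step[of n] n by (simp add: P_def)
  qed simp
  show ?thesis
  proof (rule that[of \<tau>])
    show "\<tau> k \<le> n" if "N \<le> n" "e N + real k \<le> e n" for k n
      unfolding \<tau>_def by (rule Least_le) (simp add: P_def that)
  qed (use P upper in \<open>auto simp: P_def\<close>)
qed

lemma deviation_between_levels:
  fixes s e :: "nat \<Rightarrow> real"
  assumes "mono s" "mono e" "l \<le> n" "n \<le> r"
  shows "\<bar>s n - e n\<bar> \<le> max \<bar>s l - e l\<bar> \<bar>s r - e r\<bar> + (e r - e l)"
  using monoD[OF assms(1,3)] monoD[OF assms(1,4)] monoD[OF assms(2,3)] monoD[OF assms(2,4)]
  by linarith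

section \<open>Growth of the variance bound\<close>

lemma superlinear_of_quotient:
  fixes g :: "real \<Rightarrow> real"
  assumes quot: "mono_on {0<..} (\<lambda>x. g x / x)"
    and "0 < x" "1 \<le> c"
  shows "c * g x \<le> g (c * x)"
proof -
  have "g x / x \<le> g (c * x) / (c * x)"
    by (rule mono_onD[OF quot]) (use assms(2,3) in auto)
  then show ?thesis
    using assms(2,3) by (simp add: field_simps)
qed

lemma powr_growth_of_quotient:
  fixes g :: "real \<Rightarrow> real"
  assumes pos: "\<And>x. x > 0 \<Longrightarrow> g x > 0"
    and quot: "mono_on {0<..} (\<lambda>x. x powr p / g x)"
    and "0 < x" "1 \<le> c"
  shows "g (c * x) \<le> c powr p * g x"
proof -
  have "x powr p / g x \<le> (c * x) powr p / g (c * x)"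
    by (rule mono_onD[OF quot]) (use assms(3,4) in auto)
  also have "\<dots> = x powr p * (c powr p / g (c * x))"
    using assms(3,4) by (simp add: powr_mult)
  finally have "x powr p * (1 / g x) \<le> x powr p * (c powr p / g (c * x))"
    by simp
  then have "1 / g x \<le> c powr p / g (c * x)"
    using assms(3) by (simp only: mult_le_cancel_left_pos powr_gt_zero)
  then show ?thesis
    using pos[of x] pos[of "c * x"] assms(3,4) by (simp add: field_simps)
qed

section \<open>The strong law\<close>

theorem theorem1:
  fixes M :: "'a measure" and A :: "nat \<Rightarrow> 'a set" and \<psi> g :: "real \<Rightarrow> real"
  defines "S \<equiv> occurrences A" and "E \<equiv> prob_sum M A"
  assumes "prob_space M"
    and "\<And>n. n \<ge> 1 \<Longrightarrow> A n \<in> sets M"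
    and "mono_on {0..} \<psi>" and "\<And>x. x \<ge> 0 \<Longrightarrow> \<psi> x > 0"
    and "summable (\<lambda>n. 1 / (real (Suc n) * \<psi> (real (Suc n))))"
    and "\<And>x. x \<ge> 0 \<Longrightarrow> g x > 0"
    and "\<exists>\<delta>. 0 < \<delta> \<and> \<delta> < 1 \<and>
           mono_on {0<..} (\<lambda>x. g x / x) \<and> mono_on {0<..} (\<lambda>x. x powr (2 - \<delta>) / g x)"
    and "filterlim E at_top sequentially"
    and "\<forall>\<^sub>F n in sequentially. \<forall>m>n.
           prob_space.variance M (\<lambda>\<omega>. S m \<omega> - S n \<omega>) \<le> g (E m - E n)"
  shows "AE \<omega> in M.
           (\<lambda>n. (S n \<omega> - E n) / (sqrt (g (E n) * \<psi> (ln (E n))) * ln (E n) powr (3/2)))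
             \<longlonglongrightarrow> 0"
proof -
  interpret prob_space M by fact
  note A_sets = assms(4) and \<psi>_mono = assms(5) and \<psi>_pos = assms(6) and \<psi>_sum = assms(7)
    and g_pos = assms(8) and E_lim = assms(10) and var = assms(11)
  obtain \<delta> where \<delta>: "0 < \<delta>" "\<delta> < 1" and g_quot: "mono_on {0<..} (\<lambda>x. g x / x)"
    and g_quot2: "mono_on {0<..} (\<lambda>x. x powr (2 - \<delta>) / g x)"
    using assms(9) by blast
  have g_scale: "c * g x \<le> g (c * x)" if "0 < x" "1 \<le> c" for c x
    using superlinear_of_quotient[OF g_quot that] .
  have g_growth: "g (c * x) \<le> c\<^sup>2 * g x" if "0 < x" "1 \<le> c" for c x
  proof -
    have "g (c * x) \<le> c powr (2 - \<delta>) * g x"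
      by (rule powr_growth_of_quotient[OF g_pos[OF less_imp_le] g_quot2 that])
    also have "c powr (2 - \<delta>) \<le> c powr 2"
      by (rule powr_mono) (use \<delta> that in auto)
    then have "c powr (2 - \<delta>) * g x \<le> c\<^sup>2 * g x"
      using g_pos[of x] that by (intro mult_right_mono) auto
    finally show ?thesis .
  qed
  have g_mono: "g x \<le> g y" if "0 < x" "x \<le> y" for x y
  proof -
    have "1 * g x \<le> y / x * g x"
      using that g_pos[of x] by (intro mult_right_mono) auto
    also have "\<dots> \<le> g (y / x * x)"
      using that by (intro g_scale) auto
    finally show ?thesis using that by simp
  qed

  have S_Suc: "S (Suc n) \<omega> = S n \<omega> + indicator (A (Suc n)) \<omega>" for n \<omega>
    by (simp add: S_def occurrences_def)
  have E_Suc: "E (Suc n) = E n + prob (A (Suc n))" for n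
    by (simp add: E_def prob_sum_def)
  have S_mono: "mono (\<lambda>n. S n \<omega>)" for \<omega>
    by (rule mono_iff_le_Suc[THEN iffD2]) (simp add: S_Suc)
  have E_mono: "mono E"
    by (rule mono_iff_le_Suc[THEN iffD2]) (simp add: E_Suc)
  have E_nonneg: "0 \<le> E n" for n
    by (simp add: E_def prob_sum_def sum_nonneg)
  have S_nonneg: "0 \<le> S n \<omega>" for n \<omega>
    by (simp add: S_def occurrences_def sum_nonneg)
  have S_le: "S n \<omega> \<le> real n" for n \<omega>
    using sum_bounded_above[of "{1..n}" "\<lambda>k. indicator (A k) \<omega> :: real" 1]
    by (simp add: S_def occurrences_def indicator_le_1)
  have S_meas [measurable]: "S n \<in> borel_measurable M" for n
  proof -
    have "(\<lambda>\<omega>. \<Sum>k=1..n. indicator (A k) \<omega> :: real) \<in> borel_measurable M"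
      by (intro borel_measurable_sum borel_measurable_indicator) (auto intro: A_sets)
    then show ?thesis by (simp add: S_def occurrences_def[abs_def])
  qed
  have S_int: "integrable M (S n)" for n
    by (rule integrable_const_bound[where B = "real n"]) (use S_nonneg S_le in auto)
  have S_mean: "expectation (S n) = E n" for n
    unfolding S_def occurrences_def E_def prob_sum_def
    by (subst Bochner_Integration.integral_sum)
      (auto intro!: sum.cong integrable_real_indicator A_sets simp: A_sets emeasure_eq_measure)

  obtain N where N: "\<And>n m. N \<le> n \<Longrightarrow> n < m \<Longrightarrow> variance (\<lambda>\<omega>. S m \<omega> - S n \<omega>) \<le> g (E m - E n)"
    using var by (auto simp: eventually_sequentially)
  have E_step: "E (Suc n) \<le> E n + 1" for n
    by (simp add: E_Suc)
  obtain \<tau> where \<tau>_ge: "\<And>k. N \<le> \<tau> k" and \<tau>_lower: "\<And>k. E N + real k \<le> E (\<tau> k)"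
    and \<tau>_upper: "\<And>k. E (\<tau> k) < E N + real k + 1"
    and \<tau>_least: "\<And>k n. N \<le> n \<Longrightarrow> E N + real k \<le> E n \<Longrightarrow> \<tau> k \<le> n"
    using level_times_exist[OF E_step E_lim, of N] by blast
  define Y where "Y k \<omega> = S (\<tau> k) \<omega> - E (\<tau> k)" for k \<omega>

  have incr_int: "integrable M (\<lambda>\<omega>. (Y t \<omega> - Y s \<omega>)\<^sup>2)" for s t
  proof -
    let ?B = "real (\<tau> t) + real (\<tau> s) + \<bar>E (\<tau> t)\<bar> + \<bar>E (\<tau> s)\<bar>"
    have "AE \<omega> in M. norm ((Y t \<omega> - Y s \<omega>)\<^sup>2) \<le> ?B\<^sup>2"
    proof (intro AE_I2)
      fix \<omega>
      have "\<bar>Y t \<omega> - Y s \<omega>\<bar> \<le> ?B"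
        using S_nonneg[of "\<tau> t" \<omega>] S_le[of "\<tau> t" \<omega>] S_nonneg[of "\<tau> s" \<omega>] S_le[of "\<tau> s" \<omega>]
        by (simp add: Y_def)
      then show "norm ((Y t \<omega> - Y s \<omega>)\<^sup>2) \<le> ?B\<^sup>2"
        using power_mono[of "\<bar>Y t \<omega> - Y s \<omega>\<bar>" _ 2] by simp
    qed
    then show ?thesis
      by (rule integrable_const_bound) (simp add: Y_def)
  qed
  have incr_le: "(\<integral>\<omega>. (Y t \<omega> - Y s \<omega>)\<^sup>2 \<partial>M) \<le> g (2 * real (t - s))" if "s < t" for s t
  proof -
    \<comment> \<open>The variance hypothesis is for distinct indices, so distinct levels need distinct times.\<close>
    have "E (\<tau> s) < E (\<tau> t)"
      using \<tau>_lower[of t] \<tau>_upper[of s] that by linarith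
    then have lt: "\<tau> s < \<tau> t"
      using E_mono by (metis linorder_not_le monoD)
    have "(\<integral>\<omega>. (Y t \<omega> - Y s \<omega>)\<^sup>2 \<partial>M) = variance (\<lambda>\<omega>. S (\<tau> t) \<omega> - S (\<tau> s) \<omega>)"
      by (simp add: Y_def S_int S_mean algebra_simps)
    also have "\<dots> \<le> g (E (\<tau> t) - E (\<tau> s))"
      by (rule N[OF \<tau>_ge lt])
    also have "\<dots> \<le> g (2 * real (t - s))"
      using \<open>E (\<tau> s) < E (\<tau> t)\<close> \<tau>_lower[of s] \<tau>_upper[of t] that by (intro g_mono) auto
    finally show ?thesis .
  qed

  \<comment> \<open>With \<open>j = Suc i\<close>, block \<open>i\<close> treats the levels from \<open>4 ^ j\<close> to \<open>4 ^ (j + 1) = 2 ^ (2 * i + 4)\<close>;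
      starting at \<open>j = 1\<close> avoids \<open>H 0 = 0\<close>.\<close>
  define H where "H j = g (4 ^ j) * \<psi> (real j) * real j ^ 3" for j :: nat
  have H_pos: "0 < H (Suc i)" for i
    unfolding H_def by (intro mult_pos_pos g_pos \<psi>_pos) auto
  define F where "F i \<omega> = (2 * real i + 5) * dyadic_energy (\<lambda>k. Y k \<omega>) 0 (2 * i + 4) / H (Suc i)"
    for i \<omega>
  have double: "2 * g (2 * real (2 ^ J)) \<le> g (2 * real (2 ^ Suc J))" for J :: nat
    using g_scale[of "2 * 2 ^ J" 2] by simp
  note energy = integral_dyadic_energy_le[where M = M and Y = Y and G = "\<lambda>t. g (2 * real t)",
      OF incr_int incr_le double]
  have F_int: "integrable M (F i)" for i
    unfolding F_def by (intro integrable_divide integrable_mult_right energy(1))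
  have F_nonneg: "0 \<le> F i \<omega>" for i \<omega>
    unfolding F_def using dyadic_energy_nonneg H_pos[of i]
    by (intro divide_nonneg_pos mult_nonneg_nonneg) auto
  have F_le: "(\<integral>\<omega>. F i \<omega> \<partial>M) \<le> 1600 * (1 / (real (Suc i) * \<psi> (real (Suc i))))" for i
  proof -
    \<comment> \<open>\<open>1600 = 5\<^sup>2 * 8\<^sup>2\<close>: from \<open>2 * i + 5 \<le> 5 * Suc i\<close>, and from \<open>g (8 * x) \<le> 8\<^sup>2 * g x\<close>.\<close>
    let ?x = "4 ^ Suc i :: real"
    have two: "2 * 2 ^ (2 * i + 4) = 8 * ?x"
      by (simp add: power_add power_mult)
    have "(\<integral>\<omega>. F i \<omega> \<partial>M)
        = (2 * real i + 5) * (\<integral>\<omega>. dyadic_energy (\<lambda>k. Y k \<omega>) 0 (2 * i + 4) \<partial>M) / H (Suc i)"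
      unfolding F_def by simp
    also have "\<dots> \<le> (2 * real i + 5) * ((2 * real i + 5) * (64 * g ?x)) / H (Suc i)"
    proof (intro divide_right_mono mult_left_mono)
      have "(\<integral>\<omega>. dyadic_energy (\<lambda>k. Y k \<omega>) 0 (2 * i + 4) \<partial>M) \<le> (2 * real i + 5) * g (8 * ?x)"
        using energy(2)[of 0 "2 * i + 4"] two by (simp add: algebra_simps)
      also have "\<dots> \<le> (2 * real i + 5) * (64 * g ?x)"
        using g_growth[of ?x 8] by (intro mult_left_mono) auto
      finally show "(\<integral>\<omega>. dyadic_energy (\<lambda>k. Y k \<omega>) 0 (2 * i + 4) \<partial>M) \<le> \<dots>" .
    qed (use H_pos[of i] in auto)
    also have "\<dots> = (2 * real i + 5)\<^sup>2 * (64 * g ?x / H (Suc i))"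
      by (simp add: power2_eq_square)
    also have "\<dots> \<le> (5 * real (Suc i))\<^sup>2 * (64 * g ?x / H (Suc i))"
      using g_pos[of ?x] H_pos[of i] by (intro mult_right_mono power_mono) auto
    also have "\<dots> = 1600 * (1 / (real (Suc i) * \<psi> (real (Suc i))))"
      using g_pos[of ?x] \<psi>_pos[of "real (Suc i)"]
      by (simp add: H_def power2_eq_square power3_eq_cube del: of_nat_Suc)
    finally show ?thesis .
  qed
  have "AE \<omega> in M. (\<lambda>i. F i \<omega>) \<longlonglongrightarrow> 0"
  proof (rule AE_tendsto_0_of_summable_integrals[OF F_int F_nonneg])
    show "summable (\<lambda>i. \<integral>\<omega>. F i \<omega> \<partial>M)"
    proof (rule summable_comparison_test)
      show "summable (\<lambda>i. 1600 * (1 / (real (Suc i) * \<psi> (real (Suc i)))))"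
        by (intro summable_mult \<psi>_sum)
      show "\<exists>N. \<forall>i\<ge>N. norm (\<integral>\<omega>. F i \<omega> \<partial>M) \<le> 1600 * (1 / (real (Suc i) * \<psi> (real (Suc i))))"
        using F_le F_nonneg by (auto simp: integral_nonneg)
    qed
  qed
  moreover have H_lim: "filterlim (\<lambda>i. H (Suc i)) at_top sequentially"
  proof (rule filterlim_at_top_mono)
    have c: "0 < g 1 * \<psi> 0" using g_pos[of 1] \<psi>_pos[of 0] by simp
    show "filterlim (\<lambda>i. g 1 * \<psi> 0 * real (Suc i)) at_top sequentially"
      by (intro filterlim_tendsto_pos_mult_at_top[OF tendsto_const c]
          filterlim_compose[OF filterlim_real_sequentially filterlim_Suc])
    show "\<forall>\<^sub>F i in sequentially. g 1 * \<psi> 0 * real (Suc i) \<le> H (Suc i)"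
    proof (intro always_eventually allI)
      fix i
      have "g 1 \<le> g (4 ^ Suc i)" by (intro g_mono one_le_power) auto
      moreover have "\<psi> 0 \<le> \<psi> (real (Suc i))" by (intro mono_onD[OF \<psi>_mono]) auto
      moreover have "real (Suc i) ^ 1 \<le> real (Suc i) ^ 3" by (intro power_increasing) auto
      ultimately show "g 1 * \<psi> 0 * real (Suc i) \<le> H (Suc i)"
        unfolding H_def using g_pos[of 1] \<psi>_pos[of 0] g_pos[of "4 ^ Suc i"] \<psi>_pos[of "real (Suc i)"]
        by (intro mult_mono) (auto simp del: of_nat_Suc power_Suc)
    qed
  qed
  ultimately show ?thesis
  proof (elim AE_mp, intro AE_I2 impI)
    fix \<omega> assume F_lim: "(\<lambda>i. F i \<omega>) \<longlonglongrightarrow> 0"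
    let ?h = "\<lambda>x. sqrt (g x * \<psi> (ln x)) * ln x powr (3/2)"
    \<comment> \<open>The deviation \<open>Y 0\<close> at time \<open>N\<close> and the gap of \<open>E\<close> between two consecutive level times, at
        most 2, are constants that the divergence of \<open>H\<close> absorbs.\<close>
    define C where "C = \<bar>Y 0 \<omega>\<bar> + 2"
    define u where "u i = sqrt (F i \<omega>) + C / sqrt (H (Suc i))" for i
    have "u \<longlonglongrightarrow> sqrt 0 + 0"
      unfolding u_def
      by (intro tendsto_add tendsto_real_sqrt F_lim real_tendsto_divide_at_top[OF tendsto_const]
          filterlim_compose[OF sqrt_at_top H_lim])
    then have u_lim: "u \<longlonglongrightarrow> 0" by simp
    have h_ge: "sqrt (H (Suc i)) \<le> ?h x" if "4 ^ Suc i \<le> x" for i x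
    proof -
      let ?j = "real (Suc i)"
      have x: "0 < x" using that by (smt (verit) zero_less_power)
      \<comment> \<open>Base 4 is used because \<open>ln 4 \<ge> 1\<close>, so that \<open>\<psi>\<close> may be evaluated at \<open>j\<close> itself.\<close>
      have "?j \<le> ?j * ln 4"
        using ln_ge_iff[of 4 1] exp_le by (simp add: mult_left_mono[of 1 "ln 4" ?j, simplified])
      also have "\<dots> = ln (4 ^ Suc i)"
        by (subst ln_realpow) auto
      also have "\<dots> \<le> ln x"
        using that x by (subst ln_le_cancel_iff) auto
      finally have j: "?j \<le> ln x" .
      then have ln_nonneg: "0 \<le> ln x" using of_nat_0_le_iff by (rule order_trans[rotated])
      have "sqrt (H (Suc i)) = sqrt (g (4 ^ Suc i) * \<psi> ?j) * sqrt (?j ^ 3)"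
        by (simp add: H_def real_sqrt_mult)
      also have "sqrt (?j ^ 3) = ?j powr (3/2)"
        by (subst powr_half_sqrt[symmetric]) (auto simp: powr_powr simp flip: powr_numeral)
      also have "sqrt (g (4 ^ Suc i) * \<psi> ?j) * ?j powr (3/2) \<le> ?h x"
      proof (intro mult_mono real_sqrt_le_mono powr_mono2)
        show "g (4 ^ Suc i) \<le> g x" using that by (intro g_mono) auto
        show "\<psi> ?j \<le> \<psi> (ln x)" using j by (intro mono_onD[OF \<psi>_mono]) auto
      qed (use j ln_nonneg x g_pos[of x] g_pos[of "4 ^ Suc i"] \<psi>_pos[of ?j] \<psi>_pos[of "ln x"] in auto)
      finally show ?thesis .
    qed
    have Y_le: "\<bar>Y k \<omega>\<bar> \<le> \<bar>Y 0 \<omega>\<bar> + sqrt (F i \<omega>) * sqrt (H (Suc i))"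
      if "k \<le> 4 ^ Suc (Suc i)" for i k
    proof -
      have "(4::nat) ^ Suc (Suc i) = 2 ^ (2 * i + 4)"
        by (simp add: power_add power_mult)
      then have "(Y k \<omega> - Y 0 \<omega>)\<^sup>2 \<le> (2 * real i + 5) * dyadic_energy (\<lambda>k. Y k \<omega>) 0 (2 * i + 4)"
        using increment_le_dyadic_energy[of k "2 * i + 4" "\<lambda>k. Y k \<omega>" 0] that
        by (simp add: algebra_simps)
      also have "\<dots> = F i \<omega> * H (Suc i)"
        using H_pos[of i] by (simp add: F_def)
      finally have "\<bar>Y k \<omega> - Y 0 \<omega>\<bar> \<le> sqrt (F i \<omega> * H (Suc i))"
        by (metis real_sqrt_abs real_sqrt_le_mono)
      then show ?thesis by (simp add: real_sqrt_mult)
    qed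
    show "(\<lambda>n. (S n \<omega> - E n) / ?h (E n)) \<longlonglongrightarrow> 0"
    proof (rule LIMSEQ_I)
      fix r :: real assume "0 < r"
      then obtain i0 where i0: "\<And>i. i \<ge> i0 \<Longrightarrow> norm (u i) < r"
        using LIMSEQ_D[OF u_lim] by auto
      have "\<forall>\<^sub>F n in sequentially. E N + 4 ^ Suc i0 \<le> E n"
        using E_lim by (simp add: filterlim_at_top)
      then obtain n0 where n0: "\<And>n. n \<ge> n0 \<Longrightarrow> E N + 4 ^ Suc i0 \<le> E n"
        by (auto simp: eventually_sequentially)
      show "\<exists>no. \<forall>n\<ge>no. norm ((S n \<omega> - E n) / ?h (E n) - 0) < r"
      proof (intro exI[of _ "max N n0"] allI impI)
        fix n assume n: "max N n0 \<le> n"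
        define k where "k = nat \<lfloor>E n - E N\<rfloor>"
        have big: "E N + 4 ^ Suc i0 \<le> E n" using n0 n by simp
        moreover have "(0::real) < 4 ^ Suc i0" by simp
        ultimately have "0 \<le> E n - E N" by linarith
        then have k: "E N + real k \<le> E n" "E n < E N + real k + 1"
          unfolding k_def by linarith+
        have "real (4 ^ Suc i0) < real (k + 1)"
          using big k by simp
        then have k_big: "4 ^ Suc i0 \<le> k"
          by (simp only: of_nat_less_iff)
        then have "1 \<le> k"
          using one_le_power[of "4::nat" "Suc i0"] by linarith
        then obtain j where j: "4 ^ j \<le> k" "k < 4 ^ (j + 1)"
          using ex_power_ivl1[of 4 k] by auto
        have "(4::nat) ^ Suc i0 < 4 ^ (j + 1)" using k_big j(2) by (rule le_less_trans)
        then have "Suc i0 \<le> j" by (simp add: power_strict_increasing_iff del: power_Suc)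
        then obtain i where i: "j = Suc i" "i0 \<le> i" by (cases j) auto
        have E_big: "4 ^ Suc i \<le> E n"
        proof -
          have "real (4 ^ Suc i) \<le> real k" using j(1) i(1) by (simp only: of_nat_le_iff)
          then show ?thesis using k(1) E_nonneg[of N] by simp
        qed
        have lr: "\<tau> k \<le> n" "n \<le> \<tau> (k + 1)"
        proof -
          show "\<tau> k \<le> n" using n k by (intro \<tau>_least) auto
          show "n \<le> \<tau> (k + 1)"
          proof (rule ccontr)
            assume "\<not> n \<le> \<tau> (k + 1)"
            then have "E (\<tau> (k + 1)) \<le> E n" by (intro monoD[OF E_mono]) simp
            then show False using \<tau>_lower[of "k + 1"] k by simp
          qed
        qed
        have "\<bar>S n \<omega> - E n\<bar> \<le> max \<bar>Y k \<omega>\<bar> \<bar>Y (k + 1) \<omega>\<bar> + (E (\<tau> (k + 1)) - E (\<tau> k))"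
          unfolding Y_def by (rule deviation_between_levels[OF S_mono E_mono lr])
        also have "\<dots> \<le> sqrt (F i \<omega>) * sqrt (H (Suc i)) + C"
          using \<tau>_lower[of k] \<tau>_upper[of "k + 1"] Y_le[of k i] Y_le[of "k + 1" i] j i
          by (simp add: C_def)
        also have "\<dots> = u i * sqrt (H (Suc i))"
          using H_pos[of i] by (simp add: u_def distrib_right)
        also have "\<dots> \<le> u i * ?h (E n)"
          using F_nonneg[of i \<omega>] H_pos[of i]
          by (intro mult_left_mono h_ge E_big) (simp add: u_def C_def)
        finally have *: "\<bar>S n \<omega> - E n\<bar> \<le> u i * ?h (E n)" .
        have "0 < ?h (E n)"
          using h_ge[OF E_big] H_pos[of i] by (smt (verit) real_sqrt_gt_zero)
        then have "norm ((S n \<omega> - E n) / ?h (E n) - 0) \<le> u i"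
          using * by (simp add: abs_divide divide_le_eq)
        also have "\<dots> < r" using i0[OF i(2)] by simp
        finally show "norm ((S n \<omega> - E n) / ?h (E n) - 0) < r" .
      qed
    qed
  qed
qed

end
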